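(* Let $\alpha=0$, $c\ge1$ and $\epsilon>0$. Suppose the points $x^t$ are generated by the ACGD method (described in the context) with stepsizes, for $t\ge1$, $$\tau_t=\tfrac{t-1}{2},\quad \eta_t=\frac{L(\Lambda_c)}{\tau_{t+1}},\quad \theta_t=\frac{\tau_t}{\tau_{t-1}+1},\quad \omega_1=1,\ \ \omega_t=\omega_{t-1}/\theta_t\ (t\ge2).$$ Then the ergodic average $\bar x^N=\sum_{t=1}^N\omega_tx^t/\sum_{t=1}^N\omega_t$ is an $(\epsilon;\epsilon/c)$-optimal solution, i.e. $F(\bar x^N)-F_*\le\epsilon$ and $\|[g(\bar x^N)]_+\|\le\epsilon/c$, whenever $$N\ge\sqrt{\frac{2L(\Lambda_c)}{\epsilon}}\,\|x^0-x^*\|.$$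
   Context: Problem: $\min_{x\in X}\{F(x):=f(x)+u(x)\}$ subject to $g(x)\le 0$, where $X\subseteq\mathbb R^n$ is closed and convex, $f:\mathbb R^n\to\mathbb R$ and $g=(g_1,\dots,g_m):\mathbb R^n\to\mathbb R^m$ are convex (componentwise) and differentiable with Lipschitz continuous gradients, and $u$ is a convex, $\alpha$-strongly convex function, $\alpha\ge0$ (here $\alpha=0$). Norms are Euclidean, $[\cdot]_+$ is the componentwise positive part, $\nabla g(x)$ is the $m\times n$ Jacobian. The set of optimal solutions is nonempty, and there is a KKT pair: $x^*\in X$ optimal, $\lambda^*\in\mathbb R^m_+$ with $-[\nabla f(x^* )+\sum_i\lambda_i^*\nabla g_i(x^* )+u']\in N_X(x^* )$ for some $u'\in\partial u(x^* )$, $g(x^* )\le0$, $\lambda^*_ig_i(x^* )=0$ for all $i$; $F_*=F(x^* )$. Aggregate smoothness: for $\lambda\in\mathbb R^m_+$, $L_\lambda$ is a Lipschitz constant on $\mathbb R^n$ of the gradient of $f+\sum_i\lambda_ig_i$; for $\Lambda\subseteq\mathbb R^m_+$, $L(\Lambda)=\sup_{\lambda\in\Lambda}L_\lambda$. $\Lambda_r=\{0\}\cup\{\lambda^*+\lambda:\lambda\in\mathbb R^m_+,\|\lambda\|\le r\}$. ACGD method: given $x^{-1}=\underline x^0=x^0\in X$, stepsizes $\theta_t,\eta_t,\tau_t$ and weights $\omega_t$. For $t=1,\dots,N$ ($N\ge1$): set $\tilde x^t=x^{t-1}+\theta_t(x^{t-1}-x^{t-2})$, $\underline x^t=(\tau_t\underline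 x^{t-1}+\tilde x^t)/(1+\tau_t)$, $\pi^t=\nabla f(\underline x^t)$, $\nu^t=\nabla g(\underline x^t)$, and $$x^t\in\operatorname{argmin}_{x\in X}\{\langle\pi^t,x\rangle+u(x)+\tfrac{\eta_t}{2}\|x-x^{t-1}\|^2:\ \nu^t(x-\underline x^t)+g(\underline x^t)\le0\}.$$ The method identifies this step with the $x$-component of a saddle point $(x^t,\lambda^t)$ of $\min_{x\in X}\max_{\lambda\in\mathbb R^m_+}\langle\pi^t,x\rangle+\langle\lambda,\nu^t(x-\underline x^t)+g(\underline x^t)\rangle+u(x)+\frac{\eta_t}{2}\|x-x^{t-1}\|^2$, i.e. a multiplier $\lambda^t$ is taken to exist. *)

theory Defs
  imports "HOL-Analysis.Analysis"
begin

definition gradient :: "('a::euclidean_space \<Rightarrow> real) \<Rightarrow> 'a \<Rightarrow> 'a"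
  where "gradient f x = (THE D. GDERIV f x :> D)"

lemma GDERIV_gradient:
  fixes f :: "'a::euclidean_space \<Rightarrow> real"
  assumes "f differentiable (at x)"
  shows "GDERIV f x :> gradient f x"
proof -
  obtain f' where f': "(f has_derivative f') (at x)"
    using assms by (auto simp: differentiable_def)
  then interpret linear f' by (rule has_derivative_linear)
  have "f' h = inner h (adjoint f' 1)" for h
    using adjoint_works[OF linear_axioms, of h 1] by simp
  then have "GDERIV f x :> adjoint f' 1"
    using f' unfolding gderiv_def by (metis (no_types, lifting) ext)
  moreover have "D = D'" if "GDERIV f x :> D" "GDERIV f x :> D'" for D D'
  proof -
    have "(\<lambda>h. inner h D) = (\<lambda>h. inner h D')"
      using that by (intro has_derivative_unique[of f _ x]) (auto simp: gderiv_def)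
    then have "inner (D - D') D = inner (D - D') D'" by metis
    then have "inner (D - D') (D - D') = 0" by (simp add: inner_diff_right)
    then show ?thesis by simp
  qed
  ultimately show ?thesis
    unfolding gradient_def by (metis (mono_tags, lifting) theI)
qed

definition normal_cone :: "'a::real_inner set \<Rightarrow> 'a \<Rightarrow> 'a set"
  where "normal_cone X x = {v. \<forall>y\<in>X. inner v (y - x) \<le> 0}"

text \<open>Subdifferential at \<open>x \<in> D\<close> of a convex function with effective domain \<open>D\<close>, that is,
  of the function which equals \<open>u\<close> on \<open>D\<close> and is infinite elsewhere.\<close>
definition subdifferential :: "'a::real_inner set \<Rightarrow> ('a \<Rightarrow> real) \<Rightarrow> 'a \<Rightarrow> 'a set"
  where "subdifferential D u x = {v. \<forall>y\<in>D. u y \<ge> u x + inner v (y - x)}"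

definition pos_part :: "real ^ 'm \<Rightarrow> real ^ 'm"
  where "pos_part v = (\<chi> i. max 0 (v $ i))"

text \<open>Inequalities between vectors are componentwise.\<close>
definition optimal_solution ::
    "(real ^ 'n) set \<Rightarrow> (real ^ 'n \<Rightarrow> real) \<Rightarrow> (real ^ 'n \<Rightarrow> real ^ 'm) \<Rightarrow> real ^ 'n \<Rightarrow> bool"
  where "optimal_solution X F g x \<longleftrightarrow> is_arg_min F (\<lambda>y. y \<in> X \<and> g y \<le> 0) x"

definition KKT_pair ::
    "(real ^ 'n) set \<Rightarrow> (real ^ 'n) set \<Rightarrow> (real ^ 'n \<Rightarrow> real) \<Rightarrow> (real ^ 'n \<Rightarrow> real ^ 'm)
      \<Rightarrow> (real ^ 'n \<Rightarrow> real) \<Rightarrow> real ^ 'n \<Rightarrow> real ^ 'm \<Rightarrow> bool"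
  where "KKT_pair X D f g u x l \<longleftrightarrow>
    optimal_solution X (\<lambda>y. f y + u y) g x \<and> 0 \<le> l \<and>
    (\<exists>u' \<in> subdifferential D u x.
       - (gradient f x + (\<Sum>i\<in>UNIV. l $ i *\<^sub>R gradient (\<lambda>y. g y $ i) x) + u') \<in> normal_cone X x) \<and>
    (\<forall>i. l $ i * g x $ i = 0)"

definition multiplier_set :: "real ^ 'm \<Rightarrow> real \<Rightarrow> (real ^ 'm) set"
  where "multiplier_set l0 r = {0} \<union> {l0 + l |l. 0 \<le> l \<and> norm l \<le> r}"

definition saddle_point ::
    "'a set \<Rightarrow> 'b set \<Rightarrow> ('a \<Rightarrow> 'b \<Rightarrow> real) \<Rightarrow> 'a \<Rightarrow> 'b \<Rightarrow> bool"
  where "saddle_point X Y K x y \<longleftrightarrow> x \<in> X \<and> y \<in> Y \<and>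
    (\<forall>y'\<in>Y. K x y' \<le> K x y) \<and> (\<forall>x'\<in>X. K x y \<le> K x' y)"

text \<open>\<open>z\<close> is the sequence of extrapolated points at which gradients are evaluated. The
  convention that the iterate of index \<open>-1\<close> equals \<open>x 0\<close> is built in: for \<open>t = 1\<close>, the truncated
  subtraction gives \<open>x (t - 2) = x 0\<close>. The last conjunct of the step says that the constrained
  subproblem has a Lagrange multiplier.\<close>
definition ACGD_iterates ::
    "(real ^ 'n) set \<Rightarrow> (real ^ 'n \<Rightarrow> real) \<Rightarrow> (real ^ 'n \<Rightarrow> real ^ 'm) \<Rightarrow> (real ^ 'n \<Rightarrow> real)
      \<Rightarrow> (nat \<Rightarrow> real) \<Rightarrow> (nat \<Rightarrow> real) \<Rightarrow> (nat \<Rightarrow> real) \<Rightarrow> nat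
      \<Rightarrow> (nat \<Rightarrow> real ^ 'n) \<Rightarrow> (nat \<Rightarrow> real ^ 'n) \<Rightarrow> bool"
  where "ACGD_iterates X f g u \<theta> \<eta> \<tau> N x z \<longleftrightarrow>
    x 0 \<in> X \<and> z 0 = x 0 \<and>
    (\<forall>t\<in>{1..N}.
       let xt = x (t - 1) + \<theta> t *\<^sub>R (x (t - 1) - x (t - 2));
           p = gradient f (z t);
           \<nu> = jacobian g (at (z t));
           obj = (\<lambda>y. inner p y + u y + \<eta> t / 2 * (norm (y - x (t - 1)))\<^sup>2);
           con = (\<lambda>y. \<nu> *v (y - z t) + g (z t))
       in z t = (\<tau> t *\<^sub>R z (t - 1) + xt) /\<^sub>R (1 + \<tau> t) \<and>
          is_arg_min obj (\<lambda>y. y \<in> X \<and> con y \<le> 0) (x t) \<and>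
          (\<exists>l. saddle_point X {l. 0 \<le> l} (\<lambda>y l. obj y + inner l (con y)) (x t) l))"

end

theory Submission
  imports Defs
begin

text \<open>
  With the prescribed parameters, \<open>\<theta> t = (t - 1) / t\<close> and \<open>\<omega> t = t\<close>, and the method is Nesterov's
  accelerated gradient method in disguise. Write \<open>a t\<close> for the average of \<open>x 1, \<dots>, x t\<close> with
  weights \<open>1, \<dots>, t\<close>, and \<open>\<gamma> = 2 / (t + 1)\<close>. Then gradients are evaluated at
  \<open>z t = (1 - \<gamma>) a (t - 1) + \<gamma> x (t - 1)\<close> (\<open>extrapolated_point\<close>), while
  \<open>a t = (1 - \<gamma>) a (t - 1) + \<gamma> x t\<close>, so that \<open>a t - z t = \<gamma> (x t - x (t - 1))\<close>.

  The iterates do not depend on a choice of multiplier, but for each \<open>l \<ge> 0\<close> whose Lagrangian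
  \<open>f + l \<bullet> g\<close> has an \<open>L\<close>-Lipschitz gradient, they behave like an accelerated method for the
  composite function \<open>G = f + l \<bullet> g + u\<close>. The descent inequality at \<open>z t\<close> bounds \<open>G (a t)\<close>
  by \<open>(1 - \<gamma>) G (a (t - 1))\<close> plus \<open>\<gamma>\<close> times the linearized value at \<open>x t\<close>
  (\<open>accelerated_step\<close>). The saddle point property of the subproblem bounds this linearized value:
  the multiplier of the subproblem is a best reply to \<open>x t\<close>, so it may replace \<open>l\<close>, and \<open>x t\<close>
  minimizes the regularized linearized Lagrangian, so up to a difference of squared distances it
  does at least as well as the solution \<open>xs\<close>, where the linearized constraints hold by convexity
  (\<open>saddle_step\<close>). Multiplied by \<open>t (t + 1)\<close>, the two bounds telescope to
  \<open>N (N + 1) (G (a N) - F xs) \<le> 2 L \<parallel>xs - x 0\<parallel>\<^sup>2\<close> (\<open>ACGD_rate\<close>). The assumption on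
  \<open>N\<close> makes this \<open>G (a N) - F xs \<le> \<epsilon>\<close>.

  Two choices of \<open>l\<close> finish the proof. With \<open>l = 0\<close> the inequality is the bound on the objective.
  With \<open>l = ls + c v / \<parallel>v\<parallel>\<close>, where \<open>v\<close> is the positive part of \<open>g (a N)\<close>, it exceeds its
  instance for \<open>ls\<close> by \<open>c \<parallel>v\<parallel>\<close> on the left. Since \<open>xs\<close> minimizes the Lagrangian for \<open>ls\<close>
  over \<open>X\<close> (\<open>KKT_lagrangian_minimal\<close>), that instance has a nonnegative left side, and
  \<open>c \<parallel>v\<parallel> \<le> \<epsilon>\<close> follows.
\<close>

section \<open>Convex functions with Lipschitz gradient\<close>

lemma has_derivative_gradient:
  fixes f :: "'a::euclidean_space \<Rightarrow> real"
  assumes "f differentiable (at x)"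
  shows "(f has_derivative (\<lambda>d. inner (gradient f x) d)) (at x)"
  using GDERIV_gradient[OF assms] by (simp add: gderiv_def inner_commute)

lemma DERIV_along_line:
  fixes f :: "'a::euclidean_space \<Rightarrow> real"
  assumes "\<And>y. f differentiable (at y)"
  shows "((\<lambda>s. f (x + s *\<^sub>R d)) has_real_derivative inner (gradient f (x + s *\<^sub>R d)) d) (at s)"
proof -
  have "((\<lambda>s. x + s *\<^sub>R d) has_derivative (\<lambda>s. s *\<^sub>R d)) (at s)"
    by (auto intro!: derivative_eq_intros)
  from has_derivative_compose[OF this has_derivative_gradient[OF assms]]
  show ?thesis
    by (simp add: has_field_derivative_def inner_commute mult_commute_abs)
qed

text \<open>Restriction to the segment from \<open>x\<close> to \<open>y\<close> reduces this to the tangent inequality on the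
  real line.\<close>

lemma convex_on_above_tangent:
  fixes f :: "'a::euclidean_space \<Rightarrow> real"
  assumes conv: "convex_on UNIV f" and diff: "\<And>y. f differentiable (at y)"
  shows "f x + inner (gradient f x) (y - x) \<le> f y"
proof -
  let ?\<phi> = "\<lambda>s. f (x + s *\<^sub>R (y - x))"
  have "convex_on UNIV ?\<phi>"
  proof (intro convex_onI)
    fix t a b :: real assume "0 < t" "t < 1"
    moreover have "x + ((1 - t) *\<^sub>R a + t *\<^sub>R b) *\<^sub>R (y - x)
        = (1 - t) *\<^sub>R (x + a *\<^sub>R (y - x)) + t *\<^sub>R (x + b *\<^sub>R (y - x))"
      by (simp add: algebra_simps)
    ultimately show "?\<phi> ((1 - t) *\<^sub>R a + t *\<^sub>R b) \<le> (1 - t) * ?\<phi> a + t * ?\<phi> b"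
      using convex_onD[OF conv, of t] by simp
  qed auto
  moreover have "(?\<phi> has_real_derivative inner (gradient f x) (y - x)) (at 0 within UNIV)"
    using DERIV_along_line[of f x "y - x" 0] diff by simp
  ultimately have "?\<phi> 1 - ?\<phi> 0 \<ge> inner (gradient f x) (y - x) * (1 - 0)"
    by (intro convex_on_imp_above_tangent[where A = UNIV]) auto
  then show ?thesis by simp
qed

text \<open>The descent lemma. Along the segment, the difference of the two sides has
  nonpositive derivative, because the gradient at distance \<open>s \<parallel>d\<parallel>\<close> deviates by at most
  \<open>L s \<parallel>d\<parallel>\<close>.\<close>

lemma lipschitz_gradient_upper_bound:
  fixes f :: "'a::euclidean_space \<Rightarrow> real"
  assumes diff: "\<And>y. f differentiable (at y)" and lip: "L-lipschitz_on UNIV (gradient f)"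
  shows "f y \<le> f x + inner (gradient f x) (y - x) + L / 2 * (norm (y - x))\<^sup>2"
proof -
  define d where "d = y - x"
  define \<phi> where "\<phi> s = f (x + s *\<^sub>R d) - s * inner (gradient f x) d - L / 2 * s\<^sup>2 * (norm d)\<^sup>2" for s
  have deriv: "(\<phi> has_real_derivative
      inner (gradient f (x + s *\<^sub>R d)) d - inner (gradient f x) d - L * s * (norm d)\<^sup>2) (at s)" for s
    unfolding \<phi>_def using diff
    by (auto intro!: derivative_eq_intros DERIV_along_line)
  have nonpos: "inner (gradient f (x + s *\<^sub>R d)) d - inner (gradient f x) d - L * s * (norm d)\<^sup>2 \<le> 0"
    if "0 \<le> s" for s
  proof -
    have "inner (gradient f (x + s *\<^sub>R d) - gradient f x) d
        \<le> norm (gradient f (x + s *\<^sub>R d) - gradient f x) * norm d"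
      by (rule norm_cauchy_schwarz)
    also have "\<dots> \<le> L * norm (s *\<^sub>R d) * norm d"
      using lipschitz_onD[OF lip, of "x + s *\<^sub>R d" x]
      by (intro mult_right_mono) (auto simp: dist_norm)
    also have "\<dots> = L * s * (norm d)\<^sup>2"
      using that by (simp add: power2_eq_square)
    finally show ?thesis by (simp add: inner_diff_left)
  qed
  have "\<phi> 1 \<le> \<phi> 0"
  proof (rule DERIV_nonpos_imp_nonincreasing[of 0 1 \<phi>])
    fix s :: real assume "0 \<le> s"
    from deriv[of s] nonpos[OF this]
    show "\<exists>y. (\<phi> has_real_derivative y) (at s) \<and> y \<le> 0" by blast
  qed simp
  then show ?thesis by (simp add: \<phi>_def d_def)
qed

section \<open>Minimizers of a convex function plus a squared distance\<close>

lemma norm_add_square: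
  fixes a b :: "'a::real_inner"
  shows "(norm (a + b))\<^sup>2 = (norm a)\<^sup>2 + 2 * inner a b + (norm b)\<^sup>2"
  unfolding power2_norm_eq_inner by (simp add: inner_add_left inner_add_right inner_commute)

text \<open>The minimizer beats every other point by the strong convexity margin \<open>\<eta> / 2 \<parallel>y - xp\<parallel>\<^sup>2\<close>.
  Comparison with the points of the segment from \<open>xp\<close> to \<open>y\<close> shows that the directional
  derivative bound \<open>A\<close> towards \<open>y\<close> is nonnegative, which needs no smoothness of \<open>\<phi>\<close>.\<close>

lemma prox_three_point:
  fixes p :: "'a::real_inner" and \<phi> :: "'a \<Rightarrow> real"
  assumes conv: "convex_on X \<phi>" and xp: "xp \<in> X" and y: "y \<in> X"
    and min: "\<And>w. w \<in> X \<Longrightarrow> \<phi> xp + \<eta> / 2 * (norm (xp - p))\<^sup>2 \<le> \<phi> w + \<eta> / 2 * (norm (w - p))\<^sup>2"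
  shows "\<phi> xp + \<eta> / 2 * ((norm (xp - p))\<^sup>2 + (norm (y - xp))\<^sup>2) \<le> \<phi> y + \<eta> / 2 * (norm (y - p))\<^sup>2"
proof -
  define A where "A = \<phi> y - \<phi> xp + \<eta> * inner (xp - p) (y - xp)"
  define B where "B = \<eta> / 2 * (norm (y - xp))\<^sup>2"
  have "0 \<le> A + s * B" if s: "0 < s" "s < 1" for s
  proof -
    define w where "w = (1 - s) *\<^sub>R xp + s *\<^sub>R y"
    have wX: "w \<in> X"
      unfolding w_def using convexD_alt[OF convex_on_imp_convex[OF conv] xp y] s by simp
    have "\<phi> w \<le> (1 - s) * \<phi> xp + s * \<phi> y"
      unfolding w_def using convex_onD[OF conv, of s xp y] s xp y by simp
    moreover have "w - p = (xp - p) + s *\<^sub>R (y - xp)"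
      by (simp add: w_def algebra_simps)
    then have "(norm (w - p))\<^sup>2
        = (norm (xp - p))\<^sup>2 + 2 * s * inner (xp - p) (y - xp) + s\<^sup>2 * (norm (y - xp))\<^sup>2"
      by (simp only: norm_add_square) (simp add: power_mult_distrib)
    ultimately have "\<phi> xp + \<eta> / 2 * (norm (xp - p))\<^sup>2 \<le> (1 - s) * \<phi> xp + s * \<phi> y + \<eta> / 2 *
        ((norm (xp - p))\<^sup>2 + 2 * s * inner (xp - p) (y - xp) + s\<^sup>2 * (norm (y - xp))\<^sup>2)"
      using min[OF wX] by simp
    then have "0 \<le> s * (A + s * B)"
      by (simp add: A_def B_def algebra_simps power2_eq_square)
    then show ?thesis using s by (simp add: zero_le_mult_iff)
  qed
  then have ev: "\<forall>\<^sub>F s in at_right 0. 0 \<le> A + s * B"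
    unfolding eventually_at_right_field by (intro exI[of _ 1]) auto
  have "((\<lambda>s. A + s * B) \<longlongrightarrow> A + 0 * B) (at_right 0)"
    by (intro tendsto_intros)
  then have "0 \<le> A"
    using tendsto_lowerbound[OF _ ev] by simp
  moreover have "(norm (y - p))\<^sup>2
      = (norm (xp - p))\<^sup>2 + 2 * inner (xp - p) (y - xp) + (norm (y - xp))\<^sup>2"
    using norm_add_square[of "xp - p" "y - xp"] by simp
  ultimately show ?thesis by (simp add: A_def distrib_left)
qed

section \<open>The Lagrangian\<close>

lemma inner_vec_nonneg_nonpos:
  fixes l v :: "real ^ 'm"
  assumes "0 \<le> l" "v \<le> 0"
  shows "inner l v \<le> 0"
  using assms unfolding inner_vec_def
  by (intro sum_nonpos) (auto simp: less_eq_vec_def mult_nonneg_nonpos)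

locale convex_constrained =
  fixes f :: "real ^ 'n \<Rightarrow> real" and g :: "real ^ 'n \<Rightarrow> real ^ 'm"
  assumes f_convex: "convex_on UNIV f" and f_diff: "\<And>y. f differentiable (at y)"
    and g_convex: "\<And>i. convex_on UNIV (\<lambda>y. g y $ i)" and g_diff: "\<And>y. g differentiable (at y)"
begin

definition lagrangian :: "real ^ 'm \<Rightarrow> real ^ 'n \<Rightarrow> real"
  where "lagrangian l y = f y + inner l (g y)"

lemma g_has_derivative: "(g has_derivative (\<lambda>d. jacobian g (at y) *v d)) (at y)"
  using g_diff[of y] by (simp add: jacobian_works)

lemma g_component_differentiable: "(\<lambda>y. g y $ i) differentiable (at y)"
  using bounded_linear.has_derivative[OF bounded_linear_vec_nth g_has_derivative]
  unfolding differentiable_def by blast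

text \<open>The algorithm sees \<open>g\<close> through its Jacobian, the optimality conditions through the
  gradients of its components.\<close>

lemma jacobian_component: "(jacobian g (at y) *v d) $ i = inner (gradient (\<lambda>y. g y $ i) y) d"
proof -
  have "(\<lambda>d. (jacobian g (at y) *v d) $ i) = (\<lambda>d. inner (gradient (\<lambda>y. g y $ i) y) d)"
    by (rule has_derivative_unique[OF
        bounded_linear.has_derivative[OF bounded_linear_vec_nth g_has_derivative]
        has_derivative_gradient[OF g_component_differentiable]])
  then show ?thesis by (rule fun_cong)
qed

lemma g_linearization_le: "jacobian g (at z) *v (y - z) + g z \<le> g y"
  unfolding less_eq_vec_def
  using convex_on_above_tangent[OF g_convex g_component_differentiable]
  by (auto simp: jacobian_component add.commute)

lemma lagrangian_has_derivative:
  "(lagrangian l has_derivative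
     (\<lambda>d. inner (gradient f y) d + inner l (jacobian g (at y) *v d))) (at y)"
  unfolding lagrangian_def[abs_def]
  by (intro has_derivative_add has_derivative_gradient f_diff
      has_derivative_inner_right g_has_derivative)

lemma lagrangian_differentiable: "lagrangian l differentiable (at y)"
  using lagrangian_has_derivative unfolding differentiable_def by blast

lemma lagrangian_gradient:
  "inner (gradient (lagrangian l) y) d = inner (gradient f y) d + inner l (jacobian g (at y) *v d)"
  by (rule fun_cong[OF has_derivative_unique[OF
          has_derivative_gradient[OF lagrangian_differentiable] lagrangian_has_derivative]])

lemma lagrangian_convex:
  assumes "0 \<le> l"
  shows "convex_on UNIV (lagrangian l)"
proof -
  have "convex_on UNIV (\<lambda>y. \<Sum>i\<in>UNIV. l $ i * g y $ i)"
  proof -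
    have "convex_on UNIV (\<lambda>y. \<Sum>i\<in>I. l $ i * g y $ i)" if "finite I" for I
      using that
    proof (induction I)
      case (insert i I)
      have "convex_on UNIV (\<lambda>y. l $ i * g y $ i)"
        using assms by (intro convex_on_cmul g_convex) (auto simp: less_eq_vec_def)
      with insert show ?case by (simp add: convex_on_add)
    qed (simp add: convex_on_const)
    then show ?thesis by simp
  qed
  then show ?thesis
    unfolding lagrangian_def[abs_def] inner_vec_def
    using convex_on_add[OF f_convex] by simp
qed

text \<open>The optimality condition says that a subgradient of the convex function
  \<open>lagrangian ls + u\<close> at \<open>xs\<close> is the negative of a normal to \<open>X\<close>; complementary slackness
  identifies the value at \<open>xs\<close>.\<close>

lemma KKT_lagrangian_minimal:
  assumes kkt: "KKT_pair X D f g u xs ls" and "X \<subseteq> D" and y: "y \<in> X"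
  shows "f xs + u xs \<le> lagrangian ls y + u y"
proof -
  obtain u' where u': "u' \<in> subdifferential D u xs"
    and N: "- (gradient f xs + (\<Sum>i\<in>UNIV. ls $ i *\<^sub>R gradient (\<lambda>y. g y $ i) xs) + u')
      \<in> normal_cone X xs"
    and ls: "0 \<le> ls" and cs: "\<And>i. ls $ i * g xs $ i = 0"
    using kkt unfolding KKT_pair_def by blast
  have "(\<Sum>i\<in>UNIV. ls $ i * inner (gradient (\<lambda>y. g y $ i) xs) (y - xs))
      = inner ls (jacobian g (at xs) *v (y - xs))"
    by (simp add: inner_vec_def[of ls] jacobian_component)
  then have "0 \<le> inner (gradient (lagrangian ls) xs) (y - xs) + inner u' (y - xs)"
    using bspec[OF N[unfolded normal_cone_def mem_Collect_eq] y]
    unfolding inner_minus_left inner_add_left inner_sum_left lagrangian_gradient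
    by simp
  moreover have "u xs + inner u' (y - xs) \<le> u y"
    using u' y \<open>X \<subseteq> D\<close> unfolding subdifferential_def by blast
  moreover have "lagrangian ls xs = f xs"
    by (simp add: lagrangian_def inner_vec_def cs)
  ultimately show ?thesis
    using convex_on_above_tangent[OF lagrangian_convex[OF ls] lagrangian_differentiable, of xs y]
    by linarith
qed

section \<open>One step of the method\<close>

text \<open>The multiplier \<open>l\<close> is arbitrary: at \<open>xp\<close> the multiplier \<open>lt\<close> of the subproblem
  maximizes the pairing with the linearized constraints over all \<open>l \<ge> 0\<close>, and at the feasible
  point \<open>xs\<close> its own pairing is nonpositive. Hence one run of the method serves all multipliers at once.\<close>

lemma saddle_step:
  fixes u :: "real ^ 'n \<Rightarrow> real"
  assumes u: "convex_on X u"
    and sp: "saddle_point X {l. 0 \<le> l} (\<lambda>y l. inner (gradient f z) y + u y + \<eta> / 2 * (norm (y - p))\<^sup>2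
        + inner l (jacobian g (at z) *v (y - z) + g z)) xp lt"
    and xs: "xs \<in> X" "g xs \<le> 0" and l: "0 \<le> l"
  shows "lagrangian l z + inner (gradient (lagrangian l) z) (xp - z) + u xp
      + \<eta> / 2 * ((norm (xp - p))\<^sup>2 + (norm (xs - xp))\<^sup>2) \<le> f xs + u xs + \<eta> / 2 * (norm (xs - p))\<^sup>2"
proof -
  define con where "con y = jacobian g (at z) *v (y - z) + g z" for y
  define \<phi> where "\<phi> y = u y + (inner (gradient f z) y + inner lt (con y))" for y
  from sp have xp: "xp \<in> X" and lt: "0 \<le> lt"
    and maxl: "\<And>l'. 0 \<le> l' \<Longrightarrow> inner l' (con xp) \<le> inner lt (con xp)"
    and minx: "\<And>y. y \<in> X \<Longrightarrow> \<phi> xp + \<eta> / 2 * (norm (xp - p))\<^sup>2 \<le> \<phi> y + \<eta> / 2 * (norm (y - p))\<^sup>2"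
    unfolding saddle_point_def \<phi>_def con_def by (auto simp: algebra_simps)
  have "convex_on X (\<lambda>y. inner (gradient f z) y + inner lt (con y))"
  proof (intro convex_onI)
    fix t a b assume "0 < t" "t < (1::real)"
    have "(1 - t) *\<^sub>R a + t *\<^sub>R b - z = (1 - t) *\<^sub>R (a - z) + t *\<^sub>R (b - z)"
      by (simp add: algebra_simps)
    then have "con ((1 - t) *\<^sub>R a + t *\<^sub>R b) = (1 - t) *\<^sub>R con a + t *\<^sub>R con b"
      unfolding con_def
      by (simp add: matrix_vector_right_distrib matrix_vector_mult_scaleR algebra_simps)
    then show "inner (gradient f z) ((1 - t) *\<^sub>R a + t *\<^sub>R b)
        + inner lt (con ((1 - t) *\<^sub>R a + t *\<^sub>R b))
      \<le> (1 - t) * (inner (gradient f z) a + inner lt (con a))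
        + t * (inner (gradient f z) b + inner lt (con b))"
      by (simp only: inner_add_right inner_scaleR_right) (simp add: distrib_left)
  qed (rule convex_on_imp_convex[OF u])
  with u have "convex_on X \<phi>"
    unfolding \<phi>_def[abs_def] by (rule convex_on_add)
  from prox_three_point[OF this xp xs(1) minx]
  have "\<phi> xp + \<eta> / 2 * ((norm (xp - p))\<^sup>2 + (norm (xs - xp))\<^sup>2) \<le> \<phi> xs + \<eta> / 2 * (norm (xs - p))\<^sup>2" .
  moreover have "inner lt (con xs) \<le> 0"
    using inner_vec_nonneg_nonpos[OF lt] g_linearization_le[of z xs] xs(2)
    unfolding con_def by (meson order_trans)
  moreover have "f z + inner (gradient f z) (xs - z) \<le> f xs"
    by (rule convex_on_above_tangent[OF f_convex f_diff])
  moreover have "lagrangian l z + inner (gradient (lagrangian l) z) (xp - z)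
      = f z + inner (gradient f z) (xp - z) + inner l (con xp)"
    unfolding lagrangian_gradient by (simp add: lagrangian_def con_def inner_add_right)
  ultimately show ?thesis
    using maxl[OF l] unfolding \<phi>_def by (simp add: inner_diff_right)
qed

end

text \<open>The two combinations differ by \<open>ap - z = \<gamma> (xp - p)\<close>, so the quadratic term of the descent
  lemma carries \<open>\<gamma>\<^sup>2\<close>: this extra factor is the source of acceleration. The linear term
  splits into a part at \<open>a\<close>, absorbed by convexity of \<open>h\<close>, and a part at \<open>xp\<close>.\<close>

lemma accelerated_step:
  fixes h u :: "'a::euclidean_space \<Rightarrow> real"
  assumes h: "convex_on UNIV h" "\<And>y. h differentiable (at y)" "L-lipschitz_on UNIV (gradient h)"
    and u: "convex_on X u" and X: "a \<in> X" "xp \<in> X" and \<gamma>: "0 \<le> \<gamma>" "\<gamma> \<le> 1"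
    and z: "z = (1 - \<gamma>) *\<^sub>R a + \<gamma> *\<^sub>R p" and ap: "ap = (1 - \<gamma>) *\<^sub>R a + \<gamma> *\<^sub>R xp"
  shows "h ap + u ap \<le> (1 - \<gamma>) * (h a + u a)
    + \<gamma> * (h z + inner (gradient h z) (xp - z) + u xp + L * \<gamma> / 2 * (norm (xp - p))\<^sup>2)"
proof -
  have 1: "ap - z = \<gamma> *\<^sub>R (xp - p)"
    by (simp add: z ap algebra_simps)
  have 2: "ap - z = (1 - \<gamma>) *\<^sub>R (a - z) + \<gamma> *\<^sub>R (xp - z)"
    by (simp add: ap algebra_simps)
  have "u ap \<le> (1 - \<gamma>) * u a + \<gamma> * u xp"
    unfolding ap using convex_onD[OF u, of \<gamma> a xp] X \<gamma> by simp
  moreover have "h ap \<le> h z + inner (gradient h z) (ap - z) + L / 2 * (norm (ap - z))\<^sup>2"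
    by (rule lipschitz_gradient_upper_bound[OF h(2,3)])
  moreover have "inner (gradient h z) (ap - z)
      = (1 - \<gamma>) * inner (gradient h z) (a - z) + \<gamma> * inner (gradient h z) (xp - z)"
    unfolding 2 by (simp add: inner_add_right)
  moreover have "(norm (ap - z))\<^sup>2 = \<gamma>\<^sup>2 * (norm (xp - p))\<^sup>2"
    unfolding 1 by (simp add: power_mult_distrib)
  moreover have "(1 - \<gamma>) * (h z + inner (gradient h z) (a - z)) \<le> (1 - \<gamma>) * h a"
    using convex_on_above_tangent[OF h(1,2), of z a] \<gamma> by (intro mult_left_mono) auto
  ultimately show ?thesis
    by (simp add: algebra_simps power2_eq_square)
qed

section \<open>The running average\<close>

text \<open>The average of \<open>x 1, \<dots>, x t\<close> with weights \<open>1, \<dots>, t\<close>, in recursive form. The value at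
  \<open>0\<close> gets the coefficient \<open>0\<close> in the next step; the choice \<open>x 0\<close> keeps it in the feasible
  region.\<close>

primrec running_average :: "(nat \<Rightarrow> 'a::real_vector) \<Rightarrow> nat \<Rightarrow> 'a"
  where "running_average x 0 = x 0"
  | "running_average x (Suc t)
      = (1 - 2 / (real t + 2)) *\<^sub>R running_average x t + (2 / (real t + 2)) *\<^sub>R x (Suc t)"

lemma running_average_in_convex:
  assumes "convex X" "\<And>s. s \<le> t \<Longrightarrow> x s \<in> X"
  shows "running_average x t \<in> X"
  using assms(2)
proof (induction t)
  case (Suc t)
  then have "running_average x t \<in> X" "x (Suc t) \<in> X" by auto
  then show ?case
    unfolding running_average.simps by (intro convexD_alt assms(1)) (auto simp: field_simps)
qed auto

lemma running_average_weighted_sum: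
  "(real t * (real t + 1)) *\<^sub>R running_average x t = 2 *\<^sub>R (\<Sum>s=1..t. real s *\<^sub>R x s)"
proof (induction t)
  case (Suc t)
  have "(real (Suc t) * (real (Suc t) + 1)) *\<^sub>R running_average x (Suc t)
      = (real t * (real t + 1)) *\<^sub>R running_average x t + (2 * real (Suc t)) *\<^sub>R x (Suc t)"
  proof -
    have "real (Suc t) * (real (Suc t) + 1) * (1 - 2 / (real t + 2)) = real t * (real t + 1)"
      "real (Suc t) * (real (Suc t) + 1) * (2 / (real t + 2)) = 2 * real (Suc t)"
      by (simp_all add: field_simps)
    then show ?thesis
      by (simp only: running_average.simps scaleR_add_right scaleR_scaleR)
  qed
  also have "\<dots> = 2 *\<^sub>R (\<Sum>s=1..Suc t. real s *\<^sub>R x s)"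
    by (simp only: Suc) (simp add: scaleR_add_right)
  finally show ?case .
qed auto

text \<open>The gradient point combines the average with the last iterate. By the induction hypothesis,
  \<open>z\<close> trails the new average by a multiple of the last displacement of \<open>x\<close>, and the momentum
  parameter \<open>\<theta>\<close> is exactly the one that cancels this multiple.\<close>

lemma extrapolated_point:
  assumes tau: "\<And>t. t \<ge> 1 \<Longrightarrow> \<tau> t = (real t - 1) / 2"
    and theta: "\<And>t. t \<ge> 1 \<Longrightarrow> \<theta> t = \<tau> t / (\<tau> (t - 1) + 1)"
    and z: "\<And>t. t \<in> {1..N} \<Longrightarrow> z t = (\<tau> t *\<^sub>R z (t - 1) +
       (x (t - 1) + \<theta> t *\<^sub>R (x (t - 1) - x (t - 2)))) /\<^sub>R (1 + \<tau> t)"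
    and "t < N"
  shows "z (Suc t) = (1 - 2 / (real t + 2)) *\<^sub>R running_average x t + (2 / (real t + 2)) *\<^sub>R x t"
  using \<open>t < N\<close>
proof (induction t)
  case 0
  then show ?case using z[of 1] theta[of 1] tau[of 1] by simp
next
  case (Suc t)
  define r where "r = real t"
  have r: "r \<ge> 0" by (simp add: r_def)
  have \<tau>: "\<tau> (Suc (Suc t)) = (r + 1) / 2" "\<tau> (Suc t) = r / 2"
    by (simp_all add: tau r_def)
  have \<theta>: "\<theta> (Suc (Suc t)) = (r + 1) / (r + 2)"
    using r by (simp add: theta \<tau> field_simps)
  have zt: "z (Suc t) = running_average x (Suc t) - (2 / (r + 2)) *\<^sub>R (x (Suc t) - x t)"
    using Suc by (simp add: r_def algebra_simps)
  have c1: "inverse (1 + (r + 1) / 2) * ((r + 1) / 2) = 1 - 2 / (r + 3)"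
    "inverse (1 + (r + 1) / 2) = 2 / (r + 3)"
    using r by (simp_all add: field_simps)
  have c2: "(r + 1) / 2 * (2 / (r + 2)) = (r + 1) / (r + 2)"
    using r by (simp add: field_simps)
  have "z (Suc (Suc t)) = (((r + 1) / 2) *\<^sub>R z (Suc t)
      + (x (Suc t) + ((r + 1) / (r + 2)) *\<^sub>R (x (Suc t) - x t))) /\<^sub>R (1 + (r + 1) / 2)"
    using z[of "Suc (Suc t)"] Suc.prems by (simp only: \<tau> \<theta>) (simp add: numeral_2_eq_2)
  also have "\<dots> = (((r + 1) / 2) *\<^sub>R running_average x (Suc t) + x (Suc t)) /\<^sub>R (1 + (r + 1) / 2)"
    unfolding zt scaleR_diff_right[of "(r + 1) / 2"] scaleR_scaleR[of "(r + 1) / 2"] c2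
    by (simp only: diff_add_eq) simp
  also have "\<dots> = (1 - 2 / (r + 3)) *\<^sub>R running_average x (Suc t) + (2 / (r + 3)) *\<^sub>R x (Suc t)"
    by (simp only: scaleR_add_right scaleR_scaleR c1(1)) (simp only: c1(2))
  finally show ?case by (simp add: r_def add.commute)
qed

lemma weights_linear:
  fixes \<tau> \<theta> \<omega> :: "nat \<Rightarrow> real"
  assumes tau: "\<And>t. t \<ge> 1 \<Longrightarrow> \<tau> t = (real t - 1) / 2"
    and theta: "\<And>t. t \<ge> 1 \<Longrightarrow> \<theta> t = \<tau> t / (\<tau> (t - 1) + 1)"
    and omega: "\<omega> 1 = 1" "\<And>t. t \<ge> 2 \<Longrightarrow> \<omega> t = \<omega> (t - 1) / \<theta> t"
    and "t \<ge> 1"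
  shows "\<omega> t = real t"
  using \<open>t \<ge> 1\<close>
proof (induction t rule: dec_induct)
  case (step t)
  then have "\<theta> (Suc t) = real t / (real t + 1)"
    using theta[of "Suc t"] tau[of t] tau[of "Suc t"] by (simp add: field_simps)
  moreover have "\<omega> (Suc t) = \<omega> t / \<theta> (Suc t)"
    using omega(2)[of "Suc t"] step.hyps by simp
  ultimately show ?case using step by (simp add: add.commute)
qed (use omega in simp)

section \<open>The convergence rate\<close>

text \<open>The left side is a potential that does not increase from one step to the next. In a step
  with \<open>\<gamma> = 2 / (t + 2)\<close>, the gap contracts by \<open>1 - \<gamma>\<close>, matching the growth of the factor
  \<open>t (t + 1)\<close>; the squared distance has the constant weight \<open>(t + 1) (t + 2) \<gamma> \<eta> / 2 = 2 L\<close>; and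
  \<open>L \<gamma> \<le> \<eta>\<close> lets the proximal term absorb the error of the descent lemma.\<close>

theorem (in convex_constrained) ACGD_rate:
  fixes u :: "real ^ 'n \<Rightarrow> real"
  assumes X: "convex X" and u: "convex_on X u"
    and xs: "xs \<in> X" "g xs \<le> 0" and l: "0 \<le> l"
    and lip: "L-lipschitz_on UNIV (gradient (lagrangian l))"
    and tau: "\<And>t. t \<ge> 1 \<Longrightarrow> \<tau> t = (real t - 1) / 2"
    and eta: "\<And>t. t \<ge> 1 \<Longrightarrow> \<eta> t = L / \<tau> (t + 1)"
    and theta: "\<And>t. t \<ge> 1 \<Longrightarrow> \<theta> t = \<tau> t / (\<tau> (t - 1) + 1)"
    and iterates: "ACGD_iterates X f g u \<theta> \<eta> \<tau> N x z"
    and "t \<le> N"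
  shows "real t * (real t + 1) *
      (lagrangian l (running_average x t) + u (running_average x t) - (f xs + u xs))
    + 2 * L * (norm (xs - x t))\<^sup>2 \<le> 2 * L * (norm (xs - x 0))\<^sup>2"
  using \<open>t \<le> N\<close>
proof (induction t)
  case (Suc t)
  define r where "r = real t"
  define \<gamma> where "\<gamma> = 2 / (r + 2)"
  have r: "r \<ge> 0" by (simp add: r_def)
  have L: "L \<ge> 0" using lip by (rule lipschitz_on_nonneg)
  let ?a = "running_average x t" and ?ap = "running_average x (Suc t)"
  let ?G = "\<lambda>y. lagrangian l y + u y - (f xs + u xs)"
  have mem: "x s \<in> X" if "s \<le> N" for s
    using iterates that unfolding ACGD_iterates_def Let_def is_arg_min_def
    by (cases "s = 0") auto
  have aX: "?a \<in> X" using X mem Suc.prems by (intro running_average_in_convex) auto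
  have z: "z (Suc t) = (1 - \<gamma>) *\<^sub>R ?a + \<gamma> *\<^sub>R x t"
    unfolding \<gamma>_def r_def using iterates Suc.prems
    by (intro extrapolated_point[OF tau theta, where N = N]) (auto simp: ACGD_iterates_def Let_def)
  have "Suc t \<in> {1..N}" using Suc.prems by simp
  note iterate_step = iterates[unfolded ACGD_iterates_def Let_def, THEN conjunct2, THEN conjunct2,
      THEN bspec, OF this, unfolded diff_Suc_1]
  obtain lt where "saddle_point X {l. 0 \<le> l} (\<lambda>y l. inner (gradient f (z (Suc t))) y + u y
      + \<eta> (Suc t) / 2 * (norm (y - x t))\<^sup>2
      + inner l (jacobian g (at (z (Suc t))) *v (y - z (Suc t)) + g (z (Suc t)))) (x (Suc t)) lt"
    using iterate_step[THEN conjunct2, THEN conjunct2] by (rule exE)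
  note step = saddle_step[OF u this xs l]
  have \<eta>: "\<eta> (Suc t) = 2 * L / (r + 1)"
  proof -
    have "\<eta> (Suc t) = L / \<tau> (Suc t + 1)" by (rule eta) simp
    also have "\<tau> (Suc t + 1) = (r + 1) / 2" using tau[of "Suc t + 1"] by (simp add: r_def)
    finally show ?thesis by simp
  qed
  have \<gamma>: "0 \<le> \<gamma>" "\<gamma> \<le> 1" using r by (auto simp: \<gamma>_def field_simps)
  have "L * \<gamma> / 2 \<le> \<eta> (Suc t) / 2"
    unfolding \<eta> \<gamma>_def using r L by (simp add: field_simps mult_left_mono)
  then have "L * \<gamma> / 2 * (norm (x (Suc t) - x t))\<^sup>2 \<le> \<eta> (Suc t) / 2 * (norm (x (Suc t) - x t))\<^sup>2"
    by (intro mult_right_mono) auto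
  with step have "lagrangian l (z (Suc t)) + inner (gradient (lagrangian l) (z (Suc t))) (x (Suc t) - z (Suc t))
      + u (x (Suc t)) + L * \<gamma> / 2 * (norm (x (Suc t) - x t))\<^sup>2
    \<le> f xs + u xs + \<eta> (Suc t) / 2 * ((norm (xs - x t))\<^sup>2 - (norm (xs - x (Suc t)))\<^sup>2)"
    by (simp add: algebra_simps)
  from mult_left_mono[OF this \<gamma>(1)]
  have "lagrangian l ?ap + u ?ap \<le> (1 - \<gamma>) * (lagrangian l ?a + u ?a)
      + \<gamma> * (f xs + u xs + \<eta> (Suc t) / 2 * ((norm (xs - x t))\<^sup>2 - (norm (xs - x (Suc t)))\<^sup>2))"
    using accelerated_step[OF lagrangian_convex[OF l] lagrangian_differentiable lip u aX
        mem[OF Suc.prems] \<gamma> z, of ?ap]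
    by (simp add: \<gamma>_def r_def)
  then have "?G ?ap \<le> (1 - \<gamma>) * ?G ?a
      + \<gamma> * (\<eta> (Suc t) / 2) * ((norm (xs - x t))\<^sup>2 - (norm (xs - x (Suc t)))\<^sup>2)"
    by (simp add: algebra_simps)
  from mult_left_mono[OF this, of "(r + 1) * (r + 2)"] r
  have "(r + 1) * (r + 2) * ?G ?ap \<le> (r + 1) * (r + 2) * (1 - \<gamma>) * ?G ?a
      + (r + 1) * (r + 2) * \<gamma> * (\<eta> (Suc t) / 2) * ((norm (xs - x t))\<^sup>2 - (norm (xs - x (Suc t)))\<^sup>2)"
    by (simp add: distrib_left mult.assoc)
  moreover have "(r + 1) * (r + 2) * (1 - \<gamma>) = r * (r + 1)"
    "(r + 1) * (r + 2) * \<gamma> * (\<eta> (Suc t) / 2) = 2 * L"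
  proof -
    have "r + 1 \<noteq> 0" "r + 2 \<noteq> 0" using r by linarith+
    then show "(r + 1) * (r + 2) * (1 - \<gamma>) = r * (r + 1)"
      and "(r + 1) * (r + 2) * \<gamma> * (\<eta> (Suc t) / 2) = 2 * L"
      unfolding \<gamma>_def \<eta> by (simp_all add: divide_simps)
  qed
  ultimately have "(r + 1) * (r + 2) * ?G ?ap \<le> r * (r + 1) * ?G ?a
      + 2 * L * ((norm (xs - x t))\<^sup>2 - (norm (xs - x (Suc t)))\<^sup>2)"
    by simp
  moreover have "r * (r + 1) * ?G ?a + 2 * L * (norm (xs - x t))\<^sup>2 \<le> 2 * L * (norm (xs - x 0))\<^sup>2"
    using Suc.IH Suc.prems by (simp add: r_def)
  ultimately have "(r + 1) * (r + 2) * ?G ?ap + 2 * L * (norm (xs - x (Suc t)))\<^sup>2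
      \<le> 2 * L * (norm (xs - x 0))\<^sup>2"
    unfolding right_diff_distrib[of "2 * L"] by linarith
  moreover have "real (Suc t) * (real (Suc t) + 1) = (r + 1) * (r + 2)"
    by (simp add: r_def add.commute)
  ultimately show ?case by (simp only:)
qed simp

lemma inner_pos_part: "inner (pos_part v) v = (norm (pos_part v))\<^sup>2"
  unfolding power2_norm_eq_inner inner_vec_def
  by (intro sum.cong) (auto simp: pos_part_def max_def)

theorem corollary1:
  fixes X D :: "(real ^ 'n) set"
    and f u :: "real ^ 'n \<Rightarrow> real"
    and g :: "real ^ 'n \<Rightarrow> real ^ 'm"
    and Lc :: "real ^ 'm \<Rightarrow> real"
    and xs :: "real ^ 'n" and ls :: "real ^ 'm"
    and x z :: "nat \<Rightarrow> real ^ 'n"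
    and \<theta> \<eta> \<tau> \<omega> :: "nat \<Rightarrow> real"
    and F :: "real ^ 'n \<Rightarrow> real" and xbar :: "real ^ 'n"
    and c \<epsilon> L :: real and N :: nat
  assumes F: "F = (\<lambda>y. f y + u y)"
    and X: "closed X" "convex X"
    and f: "convex_on UNIV f" "\<And>y. f differentiable (at y)"
      "\<exists>C. C-lipschitz_on UNIV (gradient f)"
    and g: "\<And>i. convex_on UNIV (\<lambda>y. g y $ i)" "\<And>y. g differentiable (at y)"
      "\<And>i. \<exists>C. C-lipschitz_on UNIV (gradient (\<lambda>y. g y $ i))"
    and u: "convex_on D u" "X \<subseteq> D"
    and KKT: "KKT_pair X D f g u xs ls"
    and Lc: "\<And>l. 0 \<le> l \<Longrightarrow>
      (Lc l)-lipschitz_on UNIV (gradient (\<lambda>y. f y + (\<Sum>i\<in>UNIV. l $ i * g y $ i)))"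
    and L_finite: "bdd_above (Lc ` multiplier_set ls c)"
    and L: "L = (SUP l\<in>multiplier_set ls c. Lc l)"
    and c: "c \<ge> 1"
    and eps: "\<epsilon> > 0"
    and tau: "\<And>t. t \<ge> 1 \<Longrightarrow> \<tau> t = (real t - 1) / 2"
    and eta: "\<And>t. t \<ge> 1 \<Longrightarrow> \<eta> t = L / \<tau> (t + 1)"
    and theta: "\<And>t. t \<ge> 1 \<Longrightarrow> \<theta> t = \<tau> t / (\<tau> (t - 1) + 1)"
    and omega: "\<omega> 1 = 1" "\<And>t. t \<ge> 2 \<Longrightarrow> \<omega> t = \<omega> (t - 1) / \<theta> t"
    and iterates: "ACGD_iterates X f g u \<theta> \<eta> \<tau> N x z"
    and N: "N \<ge> 1" "real N \<ge> sqrt (2 * L / \<epsilon>) * norm (x 0 - xs)"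
    and xbar: "xbar = (\<Sum>t=1..N. \<omega> t *\<^sub>R x t) /\<^sub>R (\<Sum>t=1..N. \<omega> t)"
  shows "F xbar - F xs \<le> \<epsilon> \<and> norm (pos_part (g xbar)) \<le> \<epsilon> / c"
proof -
  interpret convex_constrained f g
    by standard (use f g in auto)
  have xs: "xs \<in> X" "g xs \<le> 0" and ls: "0 \<le> ls"
    using KKT by (auto simp: KKT_pair_def optimal_solution_def is_arg_min_def)
  have uX: "convex_on X u"
    using u X(2) by (auto intro: convex_on_subset)
  have x_mem: "x s \<in> X" if "s \<le> N" for s
    using iterates that unfolding ACGD_iterates_def Let_def is_arg_min_def
    by (cases "s = 0") auto
  have xbar_avg: "xbar = running_average x N"
  proof -
    have "(\<Sum>t=1..N. \<omega> t) = (\<Sum>t=1..N. real t)"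
      "(\<Sum>t=1..N. \<omega> t *\<^sub>R x t) = (\<Sum>t=1..N. real t *\<^sub>R x t)"
      using weights_linear[OF tau theta omega] by (auto intro!: sum.cong)
    moreover have "(\<Sum>t=1..N. real t) = real N * (real N + 1) / 2"
      by (induction N) (auto simp: field_simps)
    moreover have "(\<Sum>t=1..N. real t *\<^sub>R x t) = (real N * (real N + 1) / 2) *\<^sub>R running_average x N"
      using arg_cong[OF running_average_weighted_sum[of N x], of "\<lambda>v. (1/2) *\<^sub>R v"] by simp
    ultimately have "xbar = (real N * (real N + 1) / 2) *\<^sub>R running_average x N
        /\<^sub>R (real N * (real N + 1) / 2)"
      by (simp only: xbar)
    moreover have "real N * (real N + 1) / 2 > 0" using N(1) by simp
    moreover have "(w *\<^sub>R v) /\<^sub>R w = v" if "w > 0" for w and v :: "real ^ 'n"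
      using that by simp
    ultimately show ?thesis by (simp only:)
  qed
  have bound: "lagrangian l xbar + u xbar - F xs \<le> \<epsilon>" if l: "l \<in> multiplier_set ls c" for l
  proof -
    have l0: "0 \<le> l"
      using l ls by (auto simp: multiplier_set_def less_eq_vec_def)
    have "Lc l \<le> L"
      unfolding L by (rule cSUP_upper[OF l L_finite])
    then have lip: "L-lipschitz_on UNIV (gradient (lagrangian l))"
      using lipschitz_on_le[OF Lc[OF l0]] by (simp add: lagrangian_def[abs_def] inner_vec_def)
    have L0: "0 \<le> L" using lip by (rule lipschitz_on_nonneg)
    define R where "R = norm (x 0 - xs)"
    have "real N * (real N + 1) * (lagrangian l xbar + u xbar - F xs)
        + 2 * L * (norm (xs - x N))\<^sup>2 \<le> 2 * L * R\<^sup>2"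
      using ACGD_rate[OF X(2) uX xs l0 lip tau eta theta iterates order_refl]
      by (simp add: xbar_avg F R_def norm_minus_commute)
    moreover have "0 \<le> 2 * L * (norm (xs - x N))\<^sup>2" using L0 by simp
    moreover have "2 * L * R\<^sup>2 \<le> \<epsilon> * (real N)\<^sup>2"
    proof -
      have "(sqrt (2 * L / \<epsilon>) * R)\<^sup>2 \<le> (real N)\<^sup>2"
        using N(2) L0 eps by (intro power_mono) (auto simp: R_def)
      then show ?thesis
        using L0 eps by (simp add: power_mult_distrib field_simps)
    qed
    moreover have "\<epsilon> * (real N)\<^sup>2 \<le> real N * (real N + 1) * \<epsilon>"
      using eps by (simp add: power2_eq_square algebra_simps)
    ultimately have "real N * (real N + 1) * (lagrangian l xbar + u xbar - F xs)
        \<le> real N * (real N + 1) * \<epsilon>"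
      by linarith
    then show ?thesis using N(1) by (simp add: mult_le_cancel_left)
  qed
  have "F xbar - F xs \<le> \<epsilon>"
    using bound[of 0] by (simp add: multiplier_set_def lagrangian_def F)
  moreover have "norm (pos_part (g xbar)) \<le> \<epsilon> / c"
  proof (cases "pos_part (g xbar) = 0")
    case True
    then show ?thesis using eps c by simp
  next
    case False
    define v where "v = pos_part (g xbar)"
    \<comment> \<open>The increment of \<open>ls\<close> of norm \<open>c\<close> that penalizes the constraint violation most.\<close>
    define l where "l = (c / norm v) *\<^sub>R v"
    have "0 \<le> l"
      using c by (auto simp: l_def v_def pos_part_def less_eq_vec_def)
    moreover have "norm l \<le> c"
      using c False by (simp add: l_def v_def)
    ultimately have "ls + l \<in> multiplier_set ls c"
      unfolding multiplier_set_def by blast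
    then have "lagrangian (ls + l) xbar + u xbar - F xs \<le> \<epsilon>"
      by (rule bound)
    moreover have "lagrangian (ls + l) xbar = lagrangian ls xbar + inner l (g xbar)"
      by (simp add: lagrangian_def inner_add_left)
    moreover have "inner l (g xbar) = c * norm v"
      using False by (simp add: l_def v_def inner_pos_part power2_eq_square)
    moreover have "xbar \<in> X"
      unfolding xbar_avg using X(2) x_mem by (intro running_average_in_convex) auto
    then have "F xs \<le> lagrangian ls xbar + u xbar"
      unfolding F by (intro KKT_lagrangian_minimal[OF KKT u(2)])
    ultimately have "c * norm v \<le> \<epsilon>" by linarith
    then show ?thesis using c by (simp add: v_def field_simps)
  qed
  ultimately show ?thesis ..
qed

end
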